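(* Let $(a_n)$ be a sequence of positive real numbers strictly less than $1$, converging to $0$, with $0<\sup_n a_n<1$. Let $$F_n=\sqrt{\frac{1-a_n}{2}}\,(Z_1^2-1)+\sqrt{\frac{a_n}{2}}\,(Z_2^2-1),\qquad F_\infty=\frac1{\sqrt2}(Z^2-1),$$ where $Z_1,Z_2$ are independent standard normal random variables and $Z$ is standard normal. Then there exists a strictly positive constant $c$ such that, for $n$ large enough, $$W_2(F_n,F_\infty)\ge c\,(a_n)^{3/4}.$$
   Context: $W_2(F,G)=(\inf \mathbb{E}|X-Y|^2)^{1/2}$, the infimum being over all couplings $(X,Y)$ with $X\sim F$, $Y\sim G$ in law. *)

theory Defs
  imports "HOL-Probability.Probability"
begin

text \<open>A coupling \<open>(X, Y)\<close> of two laws on the real line is represented by its joint law on the plane.\<close>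

definition couplings :: "real measure \<Rightarrow> real measure \<Rightarrow> (real \<times> real) measure set" where
  "couplings \<mu> \<nu> =
     {\<pi>. prob_space \<pi> \<and> sets \<pi> = sets (borel \<Otimes>\<^sub>M borel) \<and>
         distr \<pi> borel fst = \<mu> \<and> distr \<pi> borel snd = \<nu>}"

text \<open>
  The expectation \<open>E |X - Y|^2\<close> is a nonnegative Lebesgue integral, so that couplings of infinite
  cost cannot lower the infimum. The conversion to \<open>real\<close> loses nothing as long as the infimum is
  finite, which holds for laws with finite second moments (lemma \<open>W2_cost_finite\<close>).
\<close>

definition W2 :: "real measure \<Rightarrow> real measure \<Rightarrow> real" where
  "W2 \<mu> \<nu> =
     sqrt (enn2real (INF \<pi>\<in>couplings \<mu> \<nu>. \<integral>\<^sup>+ (x, y). ennreal (\<bar>x - y\<bar>\<^sup>2) \<partial>\<pi>))"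

lemma pair_measure_in_couplings:
  fixes \<mu> \<nu> :: "real measure"
  assumes "prob_space \<mu>" "sets \<mu> = sets borel" "prob_space \<nu>" "sets \<nu> = sets borel"
  shows "\<mu> \<Otimes>\<^sub>M \<nu> \<in> couplings \<mu> \<nu>"
proof -
  interpret M: prob_space \<mu> by fact
  interpret N: prob_space \<nu> by fact
  interpret P: pair_prob_space \<mu> \<nu> ..
  have sp: "space \<mu> = UNIV" "space \<nu> = UNIV"
    using assms sets_eq_imp_space_eq[of _ "borel :: real measure"] by auto
  have s: "sets (\<mu> \<Otimes>\<^sub>M \<nu>) = sets (borel \<Otimes>\<^sub>M borel)"
    by (rule sets_pair_measure_cong) fact+
  have "distr (\<mu> \<Otimes>\<^sub>M \<nu>) borel fst = \<mu>"
  proof (rule measure_eqI)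
    fix A assume "A \<in> sets (distr (\<mu> \<Otimes>\<^sub>M \<nu>) borel fst)"
    then have A: "A \<in> sets \<mu>" "A \<in> sets borel" using assms by auto
    have "fst -` A \<inter> space (\<mu> \<Otimes>\<^sub>M \<nu>) = A \<times> space \<nu>"
      using sp by (auto simp: space_pair_measure)
    then show "emeasure (distr (\<mu> \<Otimes>\<^sub>M \<nu>) borel fst) A = emeasure \<mu> A"
      using A by (subst emeasure_distr)
        (auto simp: N.emeasure_pair_measure_Times N.emeasure_space_1 measurable_cong_sets[OF s refl])
  qed (use assms in simp)
  moreover have "distr (\<mu> \<Otimes>\<^sub>M \<nu>) borel snd = \<nu>"
  proof (rule measure_eqI)
    fix A assume "A \<in> sets (distr (\<mu> \<Otimes>\<^sub>M \<nu>) borel snd)"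
    then have A: "A \<in> sets \<nu>" "A \<in> sets borel" using assms by auto
    have "snd -` A \<inter> space (\<mu> \<Otimes>\<^sub>M \<nu>) = space \<mu> \<times> A"
      using sp by (auto simp: space_pair_measure)
    then show "emeasure (distr (\<mu> \<Otimes>\<^sub>M \<nu>) borel snd) A = emeasure \<nu> A"
      using A by (subst emeasure_distr)
        (auto simp: N.emeasure_pair_measure_Times M.emeasure_space_1 measurable_cong_sets[OF s refl])
  qed (use assms in simp)
  ultimately show ?thesis
    unfolding couplings_def using s P.prob_space_axioms by auto
qed

lemma W2_cost_finite:
  fixes \<mu> \<nu> :: "real measure"
  assumes "prob_space \<mu>" "sets \<mu> = sets borel" "prob_space \<nu>" "sets \<nu> = sets borel"
    and fin: "(\<integral>\<^sup>+ x. ennreal (x\<^sup>2) \<partial>\<mu>) < \<infinity>" "(\<integral>\<^sup>+ y. ennreal (y\<^sup>2) \<partial>\<nu>) < \<infinity>"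
  shows "(INF \<pi>\<in>couplings \<mu> \<nu>. \<integral>\<^sup>+ (x, y). ennreal (\<bar>x - y\<bar>\<^sup>2) \<partial>\<pi>) < \<infinity>"
proof -
  let ?P = "\<mu> \<Otimes>\<^sub>M \<nu>"
  have P: "?P \<in> couplings \<mu> \<nu>" by (rule pair_measure_in_couplings) fact+
  then have s: "sets ?P = sets (borel \<Otimes>\<^sub>M borel)"
    and d: "distr ?P borel fst = \<mu>" "distr ?P borel snd = \<nu>"
    by (auto simp: couplings_def)
  have [measurable]: "fst \<in> borel_measurable ?P" "snd \<in> borel_measurable ?P"
    by (auto simp: measurable_cong_sets[OF s refl])
  have "(\<integral>\<^sup>+ z. ennreal ((fst z)\<^sup>2) \<partial>?P) = (\<integral>\<^sup>+ x. ennreal (x\<^sup>2) \<partial>distr ?P borel fst)"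
    by (subst nn_integral_distr) auto
  moreover have "(\<integral>\<^sup>+ z. ennreal ((snd z)\<^sup>2) \<partial>?P) = (\<integral>\<^sup>+ y. ennreal (y\<^sup>2) \<partial>distr ?P borel snd)"
    by (subst nn_integral_distr) auto
  ultimately have f: "(\<integral>\<^sup>+ z. ennreal ((fst z)\<^sup>2) \<partial>?P) < \<infinity>" "(\<integral>\<^sup>+ z. ennreal ((snd z)\<^sup>2) \<partial>?P) < \<infinity>"
    using fin d by auto
  have "(\<integral>\<^sup>+ (x, y). ennreal (\<bar>x - y\<bar>\<^sup>2) \<partial>?P)
      \<le> (\<integral>\<^sup>+ z. 2 * ennreal ((fst z)\<^sup>2) + 2 * ennreal ((snd z)\<^sup>2) \<partial>?P)"
  proof (rule nn_integral_mono, clarsimp)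
    fix x y :: real
    have "(x - y)\<^sup>2 \<le> 2 * x\<^sup>2 + 2 * y\<^sup>2"
      using zero_le_power2[of "x + y"] by (simp add: power2_eq_square algebra_simps)
    then have "ennreal ((x - y)\<^sup>2) \<le> ennreal (2 * x\<^sup>2 + 2 * y\<^sup>2)"
      by (rule ennreal_leI)
    also have "\<dots> = 2 * ennreal (x\<^sup>2) + 2 * ennreal (y\<^sup>2)"
      by (simp add: ennreal_mult)
    finally show "ennreal ((x - y)\<^sup>2) \<le> 2 * ennreal (x\<^sup>2) + 2 * ennreal (y\<^sup>2)" .
  qed
  also have "\<dots> = 2 * (\<integral>\<^sup>+ z. ennreal ((fst z)\<^sup>2) \<partial>?P) + 2 * (\<integral>\<^sup>+ z. ennreal ((snd z)\<^sup>2) \<partial>?P)"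
    by (simp add: nn_integral_add nn_integral_cmult)
  also have "\<dots> < \<infinity>"
    using f by (simp add: ennreal_mult_less_top)
  finally show ?thesis
    using P by (meson INF_lower le_less_trans)
qed

end

theory Submission
  imports Defs
begin

text \<open>
  The law of \<open>F\<^sub>\<infinity>\<close> lives on \<open>[-1/\<surd>2, \<infinity>)\<close>, whereas the left end of the support of the law of
  \<open>F\<^sub>n\<close> lies below \<open>-1/\<surd>2\<close> by an amount of order \<open>\<surd>a\<^sub>n\<close>. Every coupling therefore has to carry the mass
  of \<open>F\<^sub>n\<close> near its left end over a distance of order \<open>\<surd>a\<^sub>n\<close> at least, whatever the rest of the plan is
  (\<open>W2_ge_mass_below_support\<close>).

  That mass is bounded below on an explicit event. If \<open>\<bar>Z\<^sub>1\<bar> \<le> \<surd>a\<^sub>n / 2\<close> and \<open>\<bar>Z\<^sub>2\<bar> \<le> 1/2\<close>, then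
  \<open>F\<^sub>n \<le> -1/\<surd>2 - \<surd>a\<^sub>n / (4 \<surd>2)\<close> as soon as \<open>a\<^sub>n \<le> 1/16\<close> (\<open>two_squares_below_support\<close>), and by
  independence this event has probability at least of order \<open>\<surd>a\<^sub>n\<close> (\<open>std_normal_small_ball\<close>).
  So the squared distance is at least of order \<open>(\<surd>a\<^sub>n)\<^sup>2 \<cdot> \<surd>a\<^sub>n = a\<^sub>n powr (3/2)\<close>, and the square root
  gives the exponent \<open>3/4\<close>. Fourth moments of the Gaussian enter only to see that the
  distance is finite, so that its conversion to a real number is faithful.
\<close>

text \<open>
  A coupling must move all mass of \<open>\<mu>\<close> on \<open>{..m - s}\<close> into \<open>{m..}\<close>, which costs at
  least \<open>s\<^sup>2\<close> per unit of mass. The second moments keep the infimum of the costs below infinity.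
\<close>

lemma W2_ge_mass_below_support:
  fixes \<mu> \<nu> :: "real measure"
  assumes "prob_space \<mu>" "sets \<mu> = sets borel" "prob_space \<nu>" "sets \<nu> = sets borel"
    and fin: "(\<integral>\<^sup>+ x. ennreal (x\<^sup>2) \<partial>\<mu>) < \<infinity>" "(\<integral>\<^sup>+ y. ennreal (y\<^sup>2) \<partial>\<nu>) < \<infinity>"
    and supp: "AE y in \<nu>. m \<le> y" and "0 \<le> s"
  shows "s * sqrt (measure \<mu> {..m - s}) \<le> W2 \<mu> \<nu>"
proof -
  interpret \<mu>: prob_space \<mu> by fact
  let ?C = "INF \<pi>\<in>couplings \<mu> \<nu>. \<integral>\<^sup>+ (x, y). ennreal (\<bar>x - y\<bar>\<^sup>2) \<partial>\<pi>"
  have "ennreal (s\<^sup>2 * measure \<mu> {..m - s}) \<le> ?C"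
  proof (rule INF_greatest)
    fix \<pi> assume "\<pi> \<in> couplings \<mu> \<nu>"
    then have s: "sets \<pi> = sets (borel \<Otimes>\<^sub>M borel)"
      and d1: "distr \<pi> borel fst = \<mu>" and d2: "distr \<pi> borel snd = \<nu>"
      by (auto simp: couplings_def)
    have [measurable]: "fst \<in> borel_measurable \<pi>" "snd \<in> borel_measurable \<pi>"
      by (auto simp: measurable_cong_sets[OF s refl])
    have "AE y in distr \<pi> borel snd. m \<le> y"
      unfolding d2 by (rule supp)
    then have ae: "AE z in \<pi>. m \<le> snd z"
      by (subst (asm) AE_distr_iff) auto
    have "ennreal (s\<^sup>2 * measure \<mu> {..m - s}) = ennreal (s\<^sup>2) * emeasure \<mu> {..m - s}"
      by (simp add: \<mu>.emeasure_eq_measure ennreal_mult)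
    also have "\<dots> = (\<integral>\<^sup>+ x. ennreal (s\<^sup>2) * indicator {..m - s} x \<partial>\<mu>)"
      using assms(2) by (subst nn_integral_cmult_indicator) auto
    also have "\<dots> = (\<integral>\<^sup>+ z. ennreal (s\<^sup>2) * indicator {..m - s} (fst z) \<partial>\<pi>)"
      unfolding d1[symmetric] by (subst nn_integral_distr) auto
    also have "\<dots> \<le> (\<integral>\<^sup>+ (x, y). ennreal (\<bar>x - y\<bar>\<^sup>2) \<partial>\<pi>)"
    proof (rule nn_integral_mono_AE, use ae in eventually_elim)
      fix z :: "real \<times> real" assume z: "m \<le> snd z"
      have "s\<^sup>2 \<le> \<bar>fst z - snd z\<bar>\<^sup>2" if "fst z \<le> m - s"
        using that z \<open>0 \<le> s\<close> by (intro power_mono) auto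
      then show "ennreal (s\<^sup>2) * indicator {..m - s} (fst z)
          \<le> (case z of (x, y) \<Rightarrow> ennreal (\<bar>x - y\<bar>\<^sup>2))"
        by (auto simp: indicator_def split_beta intro!: ennreal_leI)
    qed
    finally show "ennreal (s\<^sup>2 * measure \<mu> {..m - s})
        \<le> (\<integral>\<^sup>+ (x, y). ennreal (\<bar>x - y\<bar>\<^sup>2) \<partial>\<pi>)" .
  qed
  moreover have "?C < \<infinity>"
    by (rule W2_cost_finite) fact+
  ultimately have "s\<^sup>2 * measure \<mu> {..m - s} \<le> enn2real ?C"
    by (metis enn2real_mono enn2real_ennreal infinity_ennreal_def measure_nonneg mult_nonneg_nonneg
        zero_le_power2)
  then have "sqrt (s\<^sup>2 * measure \<mu> {..m - s}) \<le> W2 \<mu> \<nu>"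
    unfolding W2_def by (rule real_sqrt_le_mono)
  then show ?thesis
    using \<open>0 \<le> s\<close> by (simp add: real_sqrt_mult)
qed

text \<open>The density is at least its value at \<open>1\<close> on the whole interval \<open>[-t, t]\<close>.\<close>

lemma std_normal_small_ball:
  assumes "prob_space M" and Z: "distributed M lborel Z std_normal_density"
    and t: "0 \<le> t" "t \<le> 1"
  shows "2 * t * std_normal_density 1 \<le> measure M {\<omega> \<in> space M. \<bar>Z \<omega>\<bar> \<le> t}"
proof -
  interpret prob_space M by fact
  have "ennreal (2 * t * std_normal_density 1)
      = (\<integral>\<^sup>+ x. ennreal (std_normal_density 1) * indicator {-t..t} x \<partial>lborel)"
    using t by (subst nn_integral_cmult_indicator) (auto simp: ennreal_mult[symmetric] mult_ac)
  also have "\<dots> \<le> (\<integral>\<^sup>+ x. ennreal (std_normal_density x) * indicator {-t..t} x \<partial>lborel)"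
  proof (rule nn_integral_mono)
    fix x :: real
    have "std_normal_density 1 \<le> std_normal_density x" if "x \<in> {-t..t}"
    proof -
      have "x\<^sup>2 \<le> 1"
        using that t by (auto simp: abs_square_le_1)
      then show ?thesis
        by (auto simp: std_normal_density_def intro!: divide_right_mono)
    qed
    then show "ennreal (std_normal_density 1) * indicator {-t..t} x
        \<le> ennreal (std_normal_density x) * indicator {-t..t} x"
      by (auto simp: indicator_def intro!: ennreal_leI)
  qed
  also have "\<dots> = emeasure M (Z -` {-t..t} \<inter> space M)"
    using Z by (subst distributed_emeasure[OF Z]) auto
  also have "Z -` {-t..t} \<inter> space M = {\<omega> \<in> space M. \<bar>Z \<omega>\<bar> \<le> t}"
    by auto
  finally show ?thesis
    by (simp add: emeasure_eq_measure)
qed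

lemma std_normal_centered_square_second_moment:
  assumes "distributed M lborel Z std_normal_density"
  shows "(\<integral>\<^sup>+ \<omega>. ennreal (((Z \<omega>)\<^sup>2 - 1)\<^sup>2) \<partial>M) < \<infinity>"
proof -
  have "integrable lborel (\<lambda>x. std_normal_density x * x ^ 4 - 2 * (std_normal_density x * x ^ 2)
      + std_normal_density x)"
    using integrable_std_normal_moment[of 4] integrable_std_normal_moment[of 2]
      integrable_std_normal_moment[of 0] by auto
  also have "(\<lambda>x. std_normal_density x * x ^ 4 - 2 * (std_normal_density x * x ^ 2)
      + std_normal_density x) = (\<lambda>x. std_normal_density x * (x\<^sup>2 - 1)\<^sup>2)"
    by (auto simp: fun_eq_iff power2_eq_square power4_eq_xxxx algebra_simps)
  finally have "integrable M (\<lambda>\<omega>. ((Z \<omega>)\<^sup>2 - 1)\<^sup>2)"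
    by (subst (asm) distributed_integrable[OF assms]) auto
  then show ?thesis
    by (simp add: integrable_iff_bounded)
qed

text \<open>
  The weights of the two squares have \<open>2 \<alpha>\<^sup>2 \<le> 1\<close> and \<open>2 \<beta>\<^sup>2 \<le> 1\<close>, so \<open>2 (\<alpha> u)\<^sup>2 + 2 (\<beta> v)\<^sup>2\<close>, an upper bound
  of \<open>(\<alpha> u + \<beta> v)\<^sup>2\<close>, is at most \<open>u\<^sup>2 + v\<^sup>2\<close>.
\<close>

lemma square_weighted_sum_le:
  fixes a u v :: real
  assumes "0 \<le> a" "a \<le> 1"
  shows "(sqrt ((1 - a) / 2) * u + sqrt (a / 2) * v)\<^sup>2 \<le> u\<^sup>2 + v\<^sup>2"
proof -
  define p q where "p = sqrt ((1 - a) / 2) * u" and "q = sqrt (a / 2) * v"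
  have "(p + q)\<^sup>2 \<le> 2 * p\<^sup>2 + 2 * q\<^sup>2"
    using zero_le_power2[of "p - q"] by (simp add: power2_eq_square algebra_simps)
  also have "\<dots> = (1 - a) * u\<^sup>2 + a * v\<^sup>2"
    using assms by (simp add: p_def q_def power_mult_distrib)
  also have "\<dots> \<le> u\<^sup>2 + v\<^sup>2"
    using assms by (intro add_mono mult_left_le_one_le) auto
  finally show ?thesis
    by (simp add: p_def q_def)
qed

text \<open>
  At \<open>x = y = 0\<close> the combination is \<open>-(\<surd>(1 - a) + \<surd>a) / \<surd>2\<close>, below \<open>-1/\<surd>2\<close> by about \<open>\<surd>a / \<surd>2\<close>
  because \<open>1 - \<surd>(1 - a) \<le> a\<close> is of smaller order than \<open>\<surd>a\<close>. On the box considered, the squares consume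
  only a part of this gap.
\<close>

lemma two_squares_below_support:
  fixes a x y :: real
  assumes a: "0 < a" "a \<le> 1 / 16" and x: "\<bar>x\<bar> \<le> sqrt a / 2" and y: "\<bar>y\<bar> \<le> 1 / 2"
  shows "sqrt ((1 - a) / 2) * (x\<^sup>2 - 1) + sqrt (a / 2) * (y\<^sup>2 - 1)
    \<le> - (1 / sqrt 2) - sqrt a / (4 * sqrt 2)"
proof -
  define r where "r = sqrt a"
  define w where "w = sqrt (1 - a)"
  have r: "0 \<le> r" "r\<^sup>2 = a" "r \<le> 1 / 4"
    using a real_sqrt_le_mono[of a "1/16"] by (auto simp: r_def real_sqrt_divide)
  have w: "1 - a \<le> w" "w \<le> 1"
    using a real_le_rsqrt[of "1 - a" "1 - a"] power_decreasing[of 1 2 "1 - a"]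
    by (auto simp: w_def)
  have x2: "x\<^sup>2 \<le> a / 4"
    using power_mono[OF x, of 2] a by (simp add: power_divide)
  have y2: "y\<^sup>2 \<le> 1 / 4"
    using power_mono[OF y, of 2] by (simp add: power_divide)
  have "w * (x\<^sup>2 - 1) = w * x\<^sup>2 - w"
    by (simp add: algebra_simps)
  also have "\<dots> \<le> a / 4 - (1 - a)"
    using w x2 a mult_left_le_one_le[of "x\<^sup>2" w] by auto
  finally have 1: "w * (x\<^sup>2 - 1) \<le> 5 / 4 * a - 1"
    by simp
  have 2: "r * (y\<^sup>2 - 1) \<le> - (3 / 4) * r"
    using mult_left_mono[of "y\<^sup>2 - 1" "- 3 / 4" r] y2 r by simp
  \<comment> \<open>here the threshold \<open>1/16\<close> makes the error terms linear in \<open>a\<close> small against the gap \<open>\<surd>a\<close>\<close>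
  have "a \<le> r / 4"
    using r mult_left_mono[of r "1/4" r] by (simp add: power2_eq_square)
  with 1 2 r have "w * (x\<^sup>2 - 1) + r * (y\<^sup>2 - 1) \<le> - 1 - r / 4"
    by linarith
  then have "(w * (x\<^sup>2 - 1) + r * (y\<^sup>2 - 1)) / sqrt 2 \<le> (- 1 - r / 4) / sqrt 2"
    by (rule divide_right_mono) simp
  then show ?thesis
    unfolding real_sqrt_divide r_def w_def by (simp add: add_divide_distrib diff_divide_distrib)
qed

theorem lemma2p5:
  fixes a :: "nat \<Rightarrow> real"
    and M :: "'a measure" and Z1 Z2 :: "'a \<Rightarrow> real"
    and N :: "'b measure" and Z :: "'b \<Rightarrow> real"
    and F :: "nat \<Rightarrow> 'a \<Rightarrow> real" and Finf :: "'b \<Rightarrow> real"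
  assumes a_pos: "\<And>n. 0 < a n" and a_less_1: "\<And>n. a n < 1"
    and a_lim: "a \<longlonglongrightarrow> 0"
    and a_sup: "0 < (SUP n. a n)" "(SUP n. a n) < 1"
    and M: "prob_space M"
    and Z1: "distributed M lborel Z1 std_normal_density"
    and Z2: "distributed M lborel Z2 std_normal_density"
    and indep: "prob_space.indep_var M borel Z1 borel Z2"
    and N: "prob_space N"
    and Z: "distributed N lborel Z std_normal_density"
    and F: "\<And>n \<omega>. F n \<omega> =
          sqrt ((1 - a n) / 2) * ((Z1 \<omega>)\<^sup>2 - 1) + sqrt (a n / 2) * ((Z2 \<omega>)\<^sup>2 - 1)"
    and Finf: "\<And>\<omega>. Finf \<omega> = 1 / sqrt 2 * ((Z \<omega>)\<^sup>2 - 1)"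
  shows "\<exists>c>0. \<forall>\<^sub>F n in sequentially.
           W2 (distr M borel (F n)) (distr N borel Finf) \<ge> c * (a n) powr (3 / 4)"
proof -
  interpret M: prob_space M by fact
  interpret N: prob_space N by fact
  have [measurable]: "Z1 \<in> borel_measurable M" "Z2 \<in> borel_measurable M" "Z \<in> borel_measurable N"
    using distributed_measurable[OF Z1] distributed_measurable[OF Z2] distributed_measurable[OF Z]
    by simp_all
  have F_meas [measurable]: "F n \<in> borel_measurable M" for n
    by (subst F[abs_def]) measurable
  have Finf_meas [measurable]: "Finf \<in> borel_measurable N"
    by (subst Finf[abs_def]) measurable
  define \<delta> :: real where "\<delta> = std_normal_density 1"
  have \<delta>: "0 < \<delta>"
    by (simp add: \<delta>_def normal_density_pos)
  \<comment> \<open>distance \<open>\<surd>a\<^sub>n / (4 \<surd>2)\<close> times the square root of the mass \<open>\<delta>\<^sup>2 \<surd>a\<^sub>n\<close>, without the power of \<open>a\<^sub>n\<close>\<close>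
  define c where "c = \<delta> / (4 * sqrt 2)"
  have main: "c * a n powr (3 / 4) \<le> W2 (distr M borel (F n)) (distr N borel Finf)"
    if an: "a n \<le> 1 / 16" for n
  proof -
    define s where "s = sqrt (a n) / (4 * sqrt 2)"
    let ?m = "- (1 / sqrt 2) :: real"
    let ?A = "{\<omega> \<in> space M. \<bar>Z1 \<omega>\<bar> \<le> sqrt (a n) / 2}"
    let ?B = "{\<omega> \<in> space M. \<bar>Z2 \<omega>\<bar> \<le> 1 / 2}"
    have s0: "0 \<le> s"
      using a_pos[of n] by (simp add: s_def)
    have F_fin: "(\<integral>\<^sup>+ x. ennreal (x\<^sup>2) \<partial>distr M borel (F n)) < \<infinity>"
    proof -
      have "(\<integral>\<^sup>+ x. ennreal (x\<^sup>2) \<partial>distr M borel (F n)) = (\<integral>\<^sup>+ \<omega>. ennreal ((F n \<omega>)\<^sup>2) \<partial>M)"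
        by (subst nn_integral_distr) auto
      also have "\<dots> \<le> (\<integral>\<^sup>+ \<omega>. ennreal (((Z1 \<omega>)\<^sup>2 - 1)\<^sup>2) + ennreal (((Z2 \<omega>)\<^sup>2 - 1)\<^sup>2) \<partial>M)"
      proof (rule nn_integral_mono)
        fix \<omega>
        have "(F n \<omega>)\<^sup>2 \<le> ((Z1 \<omega>)\<^sup>2 - 1)\<^sup>2 + ((Z2 \<omega>)\<^sup>2 - 1)\<^sup>2"
          unfolding F using a_pos[of n] a_less_1[of n] by (intro square_weighted_sum_le) auto
        then show "ennreal ((F n \<omega>)\<^sup>2)
            \<le> ennreal (((Z1 \<omega>)\<^sup>2 - 1)\<^sup>2) + ennreal (((Z2 \<omega>)\<^sup>2 - 1)\<^sup>2)"
          by (simp flip: ennreal_plus add: ennreal_leI)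
      qed
      also have "\<dots> < \<infinity>"
        using std_normal_centered_square_second_moment[OF Z1]
          std_normal_centered_square_second_moment[OF Z2] by (simp add: nn_integral_add)
      finally show ?thesis .
    qed
    have Finf_fin: "(\<integral>\<^sup>+ y. ennreal (y\<^sup>2) \<partial>distr N borel Finf) < \<infinity>"
    proof -
      have "(\<integral>\<^sup>+ y. ennreal (y\<^sup>2) \<partial>distr N borel Finf) = (\<integral>\<^sup>+ \<omega>. ennreal ((Finf \<omega>)\<^sup>2) \<partial>N)"
        by (subst nn_integral_distr) auto
      also have "\<dots> \<le> (\<integral>\<^sup>+ \<omega>. ennreal (((Z \<omega>)\<^sup>2 - 1)\<^sup>2) \<partial>N)"
        by (intro nn_integral_mono ennreal_leI) (simp add: Finf power_mult_distrib power_divide)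
      finally show ?thesis
        using std_normal_centered_square_second_moment[OF Z] by (rule le_less_trans)
    qed
    have supp: "AE y in distr N borel Finf. ?m \<le> y"
      by (subst AE_distr_iff) (auto simp: Finf field_simps)
    have "\<delta>\<^sup>2 * sqrt (a n) = (2 * (sqrt (a n) / 2) * \<delta>) * (2 * (1 / 2) * \<delta>)"
      by (simp add: power2_eq_square)
    also have "\<dots> \<le> measure M ?A * measure M ?B"
      unfolding \<delta>_def using a_pos[of n] a_less_1[of n]
      by (intro mult_mono std_normal_small_ball M Z1 Z2) (auto intro: order.trans[of _ 1])
    also have "\<dots> = measure M (?A \<inter> ?B)"
    proof -
      have "?A \<inter> ?B = (\<lambda>\<omega>. (Z1 \<omega>, Z2 \<omega>)) -` ({x. \<bar>x\<bar> \<le> sqrt (a n) / 2} \<times> {y. \<bar>y\<bar> \<le> 1 / 2})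
          \<inter> space M"
        and "?A = Z1 -` {x. \<bar>x\<bar> \<le> sqrt (a n) / 2} \<inter> space M"
        and "?B = Z2 -` {y. \<bar>y\<bar> \<le> 1 / 2} \<inter> space M"
        by auto
      then show ?thesis
        using M.indep_varD[OF indep, of "{x. \<bar>x\<bar> \<le> sqrt (a n) / 2}" "{y. \<bar>y\<bar> \<le> 1 / 2}"] by simp
    qed
    also have "\<dots> \<le> measure M (F n -` {..?m - s} \<inter> space M)"
      using two_squares_below_support[OF a_pos an] F
      by (intro M.finite_measure_mono) (auto simp: s_def)
    also have "\<dots> = measure (distr M borel (F n)) {..?m - s}"
      by (subst measure_distr) auto
    finally have mass: "\<delta>\<^sup>2 * sqrt (a n) \<le> measure (distr M borel (F n)) {..?m - s}" .
    have "sqrt (a n) = a n powr (1 / 2)" "sqrt (sqrt (a n)) = a n powr (1 / 4)"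
      using a_pos[of n] by (simp_all add: powr_half_sqrt[symmetric] powr_powr)
    then have "a n powr (3 / 4) = sqrt (a n) * sqrt (sqrt (a n))"
      by (simp flip: powr_add)
    then have "c * a n powr (3 / 4) = s * sqrt (\<delta>\<^sup>2 * sqrt (a n))"
      using \<delta> by (simp add: c_def s_def real_sqrt_mult)
    also have "\<dots> \<le> s * sqrt (measure (distr M borel (F n)) {..?m - s})"
      using s0 mass by (intro mult_left_mono real_sqrt_le_mono)
    also have "\<dots> \<le> W2 (distr M borel (F n)) (distr N borel Finf)"
      using F_fin Finf_fin supp s0
      by (intro W2_ge_mass_below_support M.prob_space_distr N.prob_space_distr F_meas Finf_meas) auto
    finally show ?thesis .
  qed
  have "\<forall>\<^sub>F n in sequentially. a n < 1 / 16"
    using a_lim by (rule order_tendstoD) simp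
  then have "\<forall>\<^sub>F n in sequentially.
      c * a n powr (3 / 4) \<le> W2 (distr M borel (F n)) (distr N borel Finf)"
    by eventually_elim (simp add: main)
  moreover have "0 < c"
    using \<delta> by (simp add: c_def)
  ultimately show ?thesis
    by blast
qed

end
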